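(* Let $G$ be a distal totally disconnected, locally compact group. Then every compactly generated closed subgroup of $G$ is a SIN group.
   Context: Topological groups are Hausdorff. $G$ is distal if the conjugation action of $G$ on itself is distal, i.e. there are no distinct $x,y\in G$ for which some $(z,z)$, $z \in G$, lies in the closure of $\{(gxg^{-1},gyg^{-1})\mid g\in G\}$ in $G\times G$ (equivalently, no conjugacy class of a non-trivial element accumulates at $1$). A topological group $H$ is a SIN group (small invariant neighbourhoods) if it has a base of neighbourhoods of the identity consisting of sets invariant under conjugation by $H$. *)

theory Defs
  imports "HOL-Analysis.Analysis" "HOL-Algebra.Generated_Groups"
begin

locale topological_group = group G for G :: "('a, 'b) monoid_scheme" (structure) +
  fixes T :: "'a topology"
  assumes topspace_eq_carrier: "topspace T = carrier G"
    and continuous_mult: "continuous_map (prod_topology T T) T (\<lambda>(x, y). x \<otimes> y)"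
    and continuous_inv: "continuous_map T T (\<lambda>x. inv x)"
    and Hausdorff: "Hausdorff_space T"

definition totally_disconnected_space :: "'a topology \<Rightarrow> bool" where
  "totally_disconnected_space T \<longleftrightarrow>
     (\<forall>x \<in> topspace T. connected_component_of_set T x = {x})"

definition conj_by :: "('a, 'b) monoid_scheme \<Rightarrow> 'a \<Rightarrow> 'a \<Rightarrow> 'a" where
  "conj_by G g x = g \<otimes>\<^bsub>G\<^esub> x \<otimes>\<^bsub>G\<^esub> inv\<^bsub>G\<^esub> g"

definition distal_group :: "('a, 'b) monoid_scheme \<Rightarrow> 'a topology \<Rightarrow> bool" where
  "distal_group G T \<longleftrightarrow>
     \<not> (\<exists>x \<in> carrier G. \<exists>y \<in> carrier G. x \<noteq> y \<and>
          (\<exists>z \<in> carrier G.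
             (z, z) \<in> prod_topology T T closure_of
                        {(conj_by G g x, conj_by G g y) | g. g \<in> carrier G}))"

text \<open>In the library's \<^const>\<open>neighbourhood_base_at\<close>, the neighbourhoods forming the base
  need not be open.\<close>

definition SIN_group :: "('a, 'b) monoid_scheme \<Rightarrow> 'a topology \<Rightarrow> bool" where
  "SIN_group G T \<longleftrightarrow>
     neighbourhood_base_at \<one>\<^bsub>G\<^esub> (\<lambda>V. \<forall>g \<in> carrier G. conj_by G g ` V = V) T"

text \<open>Generation is algebraic: no closure is taken of the subgroup generated by the compact set.\<close>

definition compactly_generated_group :: "('a, 'b) monoid_scheme \<Rightarrow> 'a topology \<Rightarrow> bool" where
  "compactly_generated_group G T \<longleftrightarrow> (\<exists>K. compactin T K \<and> generate G K = carrier G)"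

lemma (in topological_group) topological_group_subgroup:
  assumes H: "subgroup H G"
  shows "topological_group (G\<lparr>carrier := H\<rparr>) (subtopology T H)"
proof -
  have sub: "H \<subseteq> carrier G" using H by (rule subgroup.subset)
  interpret S: group "G\<lparr>carrier := H\<rparr>" using H by (rule subgroup_imp_group)
  show ?thesis
  proof
    show "topspace (subtopology T H) = carrier (G\<lparr>carrier := H\<rparr>)"
      using sub topspace_eq_carrier by auto
    have "continuous_map (subtopology (prod_topology T T) (H \<times> H)) (subtopology T H)
            (\<lambda>(x, y). x \<otimes> y)"
      using continuous_mult subgroup.m_closed[OF H]
      by (auto simp: continuous_map_in_subtopology continuous_map_from_subtopology)
    then show "continuous_map (prod_topology (subtopology T H) (subtopology T H))
        (subtopology T H) (\<lambda>(x, y). x \<otimes>\<^bsub>G\<lparr>carrier := H\<rparr>\<^esub> y)"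
      by (simp add: subtopology_Times)
    have "continuous_map (subtopology T H) (subtopology T H) (\<lambda>x. inv x)"
      using continuous_inv subgroup.m_inv_closed[OF H]
      by (auto simp: continuous_map_in_subtopology continuous_map_from_subtopology)
    then show "continuous_map (subtopology T H) (subtopology T H)
        (\<lambda>x. inv\<^bsub>G\<lparr>carrier := H\<rparr>\<^esub> x)"
      by (rule continuous_map_eq) (use H in \<open>auto simp: m_inv_consistent\<close>)
    show "Hausdorff_space (subtopology T H)"
      using Hausdorff by (rule Hausdorff_space_subtopology)
  qed
qed

end

theory Submission
  imports Defs
begin

text \<open>For the conjugation action, let \<open>U\<close> be a compact open neighbourhood of \<open>\<one>\<close>, \<open>A\<close> a compact
  symmetric generating set containing \<open>\<one>\<close>,
  and \<open>W n\<close> the set of points that stay in \<open>U\<close> during the first \<open>n\<close> steps of every walk with steps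
  in \<open>A\<close>. Suppose that the decreasing sequence of clopen sets \<open>W n\<close> never becomes constant. Then for
  every \<open>n\<close> some point of \<open>W 0 - W 1\<close> is the endpoint of an \<open>n\<close>-step walk starting in \<open>W n\<close>, and by
  compactness a single \<open>y \<in> W 0 - W 1\<close> has this property for all \<open>n\<close>. So the orbit of \<open>y\<close> meets
  every \<open>W n\<close>, and its closure meets the compact invariant set \<open>N = (\<Inter>n. W n)\<close>. Then an idempotent
  of the enveloping semigroup maps \<open>y\<close> to a point of \<open>N\<close> and fixes that point, so distality forces
  \<open>y \<in> N\<close>, a contradiction. Hence \<open>N = W n\<close> for some \<open>n\<close>, and \<open>N\<close> is an
  open invariant neighbourhood of \<open>\<one>\<close> inside \<open>U\<close>.\<close>

section \<open>Idempotents in compact right topological semigroups\<close>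

text \<open>Zorn's lemma applies because compactness keeps the intersection of a chain of nonempty
  closed subsemigroups nonempty.\<close>

lemma minimal_closed_subsemigroup:
  assumes "compact_space X" and "topspace X \<noteq> {}"
    and closed: "\<And>a b. a \<in> topspace X \<Longrightarrow> b \<in> topspace X \<Longrightarrow> f a b \<in> topspace X"
  obtains M where "closedin X M" "M \<noteq> {}" "\<And>a b. a \<in> M \<Longrightarrow> b \<in> M \<Longrightarrow> f a b \<in> M"
    "\<And>S. \<lbrakk>closedin X S; S \<noteq> {}; \<And>a b. a \<in> S \<Longrightarrow> b \<in> S \<Longrightarrow> f a b \<in> S; S \<subseteq> M\<rbrakk> \<Longrightarrow> S = M"
proof -
  define \<A> where "\<A> = {S. closedin X S \<and> S \<noteq> {} \<and> (\<forall>a\<in>S. \<forall>b\<in>S. f a b \<in> S)}"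
  \<comment> \<open>The order is reverse inclusion, so a maximal element is a minimal
    subsemigroup.\<close>
  let ?P = "\<lambda>A B::'a set. B \<subseteq> A"
  have "\<exists>M\<in>\<A>. \<forall>S\<in>\<A>. ?P M S \<longrightarrow> S = M"
  proof (rule predicate_Zorn)
    show "partial_order_on \<A> (relation_of ?P \<A>)"
      by (rule partial_order_on_relation_ofI) auto
  next
    fix \<C> assume \<C>: "\<C> \<in> Chains (relation_of ?P \<A>)"
    then have sub: "\<C> \<subseteq> \<A>" and chain: "\<And>A B. A \<in> \<C> \<Longrightarrow> B \<in> \<C> \<Longrightarrow> A \<subseteq> B \<or> B \<subseteq> A"
      by (auto simp: Chains_def relation_of_def)
    show "\<exists>U\<in>\<A>. \<forall>A\<in>\<C>. ?P A U"
    proof (cases "\<C> = {}")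
      case True
      then show ?thesis using assms by (auto simp: \<A>_def)
    next
      case False
      \<comment> \<open>A finite nonempty subfamily of a chain has its least member as intersection,
        which gives the finite intersection property.\<close>
      have fin: "\<Inter>\<F> \<in> \<F>" if "finite \<F>" "\<F> \<noteq> {}" "\<F> \<subseteq> \<C>" for \<F>
        using that
      proof (induction rule: finite_ne_induct)
        case (insert A \<F>)
        then have "A \<subseteq> \<Inter>\<F> \<or> \<Inter>\<F> \<subseteq> A" using chain by blast
        with insert show ?case by (auto simp: Int_absorb1 Int_absorb2)
      qed auto
      have "\<Inter>\<F> \<noteq> {}" if "finite \<F>" "\<F> \<subseteq> \<C>" for \<F>
        using fin[OF that(1) _ that(2)] that(2) sub by (cases "\<F> = {}") (auto simp: \<A>_def)
      moreover have "\<forall>C\<in>\<C>. closedin X C" using sub by (auto simp: \<A>_def)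
      ultimately have "\<Inter>\<C> \<noteq> {}"
        using assms(1)[unfolded compact_space_fip, rule_format, of \<C>] by blast
      moreover have "closedin X (\<Inter>\<C>)"
        using sub False by (auto simp: \<A>_def)
      moreover have "f a b \<in> \<Inter>\<C>" if "a \<in> \<Inter>\<C>" "b \<in> \<Inter>\<C>" for a b
        using sub that by (auto simp: \<A>_def)
      ultimately have "\<Inter>\<C> \<in> \<A>" by (auto simp: \<A>_def)
      then show ?thesis by blast
    qed
  qed
  then obtain M where M: "M \<in> \<A>" and min: "\<And>S. S \<in> \<A> \<Longrightarrow> S \<subseteq> M \<Longrightarrow> S = M" by blast
  show ?thesis
  proof (rule that[of M])
    show "S = M" if "closedin X S" "S \<noteq> {}" "\<And>a b. a \<in> S \<Longrightarrow> b \<in> S \<Longrightarrow> f a b \<in> S" "S \<subseteq> M" for S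
      using that by (intro min) (simp_all add: \<A>_def)
  qed (use M in \<open>simp_all add: \<A>_def\<close>)
qed

text \<open>The Ellis--Numakura lemma.\<close>

lemma compact_right_topological_semigroup_idempotent:
  assumes "compact_space X" and "Hausdorff_space X" and "topspace X \<noteq> {}"
    and closed: "\<And>a b. a \<in> topspace X \<Longrightarrow> b \<in> topspace X \<Longrightarrow> f a b \<in> topspace X"
    and assoc: "\<And>a b c. \<lbrakk>a \<in> topspace X; b \<in> topspace X; c \<in> topspace X\<rbrakk>
                  \<Longrightarrow> f (f a b) c = f a (f b c)"
    and cont: "\<And>b. b \<in> topspace X \<Longrightarrow> continuous_map X X (\<lambda>a. f a b)"
  obtains u where "u \<in> topspace X" "f u u = u"
proof -
  obtain M where M: "closedin X M" "M \<noteq> {}" "\<And>a b. a \<in> M \<Longrightarrow> b \<in> M \<Longrightarrow> f a b \<in> M"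
    and min: "\<And>S. \<lbrakk>closedin X S; S \<noteq> {}; \<And>a b. a \<in> S \<Longrightarrow> b \<in> S \<Longrightarrow> f a b \<in> S; S \<subseteq> M\<rbrakk>
                \<Longrightarrow> S = M"
    by (rule minimal_closed_subsemigroup[of X f, OF assms(1,3) closed]) blast+
  obtain u where u: "u \<in> M" using M(2) by blast
  have top: "a \<in> topspace X" if "a \<in> M" for a
    using that closedin_subset[OF M(1)] by blast
  have "compactin X M" using assms(1) M(1) by (rule closedin_compact_space)
  \<comment> \<open>The products \<open>f a u\<close> with \<open>a\<close> in \<open>M\<close> form
    a subsemigroup of \<open>M\<close>, closed as a continuous image of a compact set. Minimality
    makes it all of \<open>M\<close>, so \<open>u\<close> itself is such a product.\<close>
  have "(\<lambda>a. f a u) ` M = M"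
  proof (rule min)
    show "closedin X ((\<lambda>a. f a u) ` M)"
      using image_compactin[OF \<open>compactin X M\<close> cont[OF top[OF u]]] \<open>Hausdorff_space X\<close>
      by (simp add: compactin_imp_closedin)
    show "f a b \<in> (\<lambda>a. f a u) ` M" if "a \<in> (\<lambda>a. f a u) ` M" "b \<in> (\<lambda>a. f a u) ` M" for a b
    proof -
      obtain x y where xy: "x \<in> M" "y \<in> M" "a = f x u" "b = f y u" using \<open>a \<in> _\<close> \<open>b \<in> _\<close> by blast
      have "f a b = f (f (f x u) y) u"
        using xy u M(3) top by (simp add: assoc)
      then show ?thesis using xy u M(3) by blast
    qed
  qed (use u M in auto)
  then obtain a where a: "a \<in> M" "f a u = u" using u by (metis imageE)
  \<comment> \<open>The elements of \<open>M\<close> fixing \<open>u\<close> from the left form a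
    nonempty closed subsemigroup; by minimality \<open>u\<close> is one of them.\<close>
  define S where "S = M \<inter> {a \<in> topspace X. f a u \<in> {u}}"
  have "S = M"
  proof (rule min)
    show "closedin X S"
      unfolding S_def
      by (intro closedin_Int M closedin_continuous_map_preimage[OF cont[OF top[OF u]]])
         (use \<open>Hausdorff_space X\<close> u top in \<open>simp add: closedin_Hausdorff_singleton\<close>)
    show "f a b \<in> S" if "a \<in> S" "b \<in> S" for a b
      using that u M(3) top by (simp add: S_def assoc)
  qed (use a top in \<open>auto simp: S_def\<close>)
  then show ?thesis using that u top by (auto simp: S_def)
qed

section \<open>Distal actions of compactly generated groups\<close>

locale continuous_action = topological_group G T
  for G :: "('a, 'b) monoid_scheme" (structure) and T :: "'a topology" +
  fixes X :: "'x topology" and act :: "'a \<Rightarrow> 'x \<Rightarrow> 'x"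
  assumes continuous_act: "continuous_map (prod_topology T X) X (\<lambda>(g, x). act g x)"
    and act_one: "x \<in> topspace X \<Longrightarrow> act \<one> x = x"
    and act_mult: "\<lbrakk>g \<in> carrier G; h \<in> carrier G; x \<in> topspace X\<rbrakk>
                     \<Longrightarrow> act (g \<otimes> h) x = act g (act h x)"
begin

definition distal :: bool where
  "distal \<longleftrightarrow> (\<forall>x\<in>topspace X. \<forall>y\<in>topspace X. \<forall>z\<in>topspace X.
     (z, z) \<in> prod_topology X X closure_of {(act g x, act g y) |g. g \<in> carrier G} \<longrightarrow> x = y)"

text \<open>The sets \<open>W n\<close> of the overview are iterates of \<open>stay A\<close> on
  \<open>U\<close>. For \<open>A = carrier G\<close> this is the largest invariant subset of
  \<open>U\<close>.\<close>

definition stay :: "'a set \<Rightarrow> 'x set \<Rightarrow> 'x set" where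
  "stay A U = {x \<in> topspace X. \<forall>k\<in>A. act k x \<in> U}"

text \<open>Endpoints of single steps from \<open>S\<close>; the iterates of \<open>push A\<close>
  collect endpoints of longer walks.\<close>

definition push :: "'a set \<Rightarrow> 'x set \<Rightarrow> 'x set" where
  "push A S = (\<lambda>(k, x). act k x) ` (A \<times> S)"

lemma continuous_map_act:
  assumes "g \<in> carrier G"
  shows "continuous_map X X (act g)"
proof -
  have "continuous_map X (prod_topology T X) (\<lambda>x. (g, x))"
    using assms topspace_eq_carrier by (auto intro: continuous_map_pairedI)
  from continuous_map_compose[OF this continuous_act] show ?thesis
    by (simp add: o_def)
qed

lemma act_closed: "g \<in> carrier G \<Longrightarrow> x \<in> topspace X \<Longrightarrow> act g x \<in> topspace X"
  using continuous_map_act by (auto dest: continuous_map_funspace)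

lemma act_inv: "g \<in> carrier G \<Longrightarrow> x \<in> topspace X \<Longrightarrow> act (inv g) (act g x) = x"
  using act_mult[of "inv g" g x] act_one by simp

text \<open>Compactness of \<open>A\<close> makes this possibly infinite intersection of open
  preimages open: the tube lemma gives one neighbourhood of \<open>x\<close> that works for all of
  \<open>A\<close>.\<close>

lemma openin_stay:
  assumes A: "compactin T A" and U: "openin X U"
  shows "openin X (stay A U)"
proof (subst openin_subopen, safe)
  fix x assume x: "x \<in> stay A U"
  define W where "W = {p \<in> topspace (prod_topology T X). (\<lambda>(g, x). act g x) p \<in> U}"
  have "openin (prod_topology T X) W"
    unfolding W_def using continuous_act U by (rule openin_continuous_map_preimage)
  moreover have "A \<times> {x} \<subseteq> W"
    using x compactin_subset_topspace[OF A] by (auto simp: stay_def W_def)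
  moreover have "x \<in> topspace X" using x by (simp add: stay_def)
  ultimately obtain V Y where VY: "openin X Y" "A \<subseteq> V" "x \<in> Y" "V \<times> Y \<subseteq> W"
    using tube_lemma_left[of T X W A x] A by metis
  have "act k z \<in> U" if "k \<in> A" "z \<in> Y" for k z
    using subsetD[OF VY(4), of "(k, z)"] VY(2) that by (auto simp: W_def)
  then have "Y \<subseteq> stay A U"
    using openin_subset[OF VY(1)] by (auto simp: stay_def)
  with VY show "\<exists>V. openin X V \<and> x \<in> V \<and> V \<subseteq> stay A U" by blast
qed

lemma closedin_stay:
  assumes A: "A \<subseteq> carrier G" and U: "closedin X U"
  shows "closedin X (stay A U)"
proof -
  have "stay A U = topspace X \<inter> (\<Inter>k\<in>A. {x \<in> topspace X. act k x \<in> U})"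
    by (auto simp: stay_def)
  also have "closedin X \<dots>"
    using A U by (cases "A = {}")
      (auto intro!: closedin_Int closedin_continuous_map_preimage continuous_map_act)
  finally show ?thesis .
qed

lemma stay_subset: "\<one> \<in> A \<Longrightarrow> stay A U \<subseteq> U"
  using act_one by (force simp: stay_def)

lemma push_stay_subset: "push A (stay A U) \<subseteq> U"
  by (auto simp: push_def stay_def)

lemma push_mono: "S \<subseteq> S' \<Longrightarrow> push A S \<subseteq> push A S'"
  by (auto simp: push_def)

lemma push_pow_mono: "S \<subseteq> S' \<Longrightarrow> (push A ^^ n) S \<subseteq> (push A ^^ n) S'"
  by (induction n) (simp_all add: push_mono)

lemma compactin_push: "compactin T A \<Longrightarrow> compactin X S \<Longrightarrow> compactin X (push A S)"
  unfolding push_def using continuous_act by (intro image_compactin) (auto simp: compactin_Times)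

lemma push_pow_imp_orbit:
  assumes "A \<subseteq> carrier G" "S \<subseteq> topspace X" "y \<in> (push A ^^ n) S"
  shows "\<exists>x\<in>S. \<exists>g\<in>carrier G. y = act g x"
  using assms(3)
proof (induction n arbitrary: y)
  case 0
  then show ?case using assms act_one by force
next
  case (Suc n)
  then obtain k x where k: "k \<in> A" "x \<in> (push A ^^ n) S" "y = act k x" by (auto simp: push_def[of A "(push A ^^ n) S"])
  with Suc.IH obtain w g where "w \<in> S" "g \<in> carrier G" "x = act g w" by blast
  with k assms have "y = act (k \<otimes> g) w" "k \<otimes> g \<in> carrier G" by (auto simp: act_mult subset_iff)
  with \<open>w \<in> S\<close> show ?case by blast
qed

lemma generate_invariant:
  assumes K: "K \<subseteq> carrier G" and N: "N \<subseteq> topspace X"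
    and inv: "\<And>k x. k \<in> K \<union> m_inv G ` K \<Longrightarrow> x \<in> N \<Longrightarrow> act k x \<in> N"
    and g: "g \<in> generate G K" and x: "x \<in> N"
  shows "act g x \<in> N"
  using g x
proof (induction arbitrary: x)
  case one
  then show ?case using N act_one by auto
next
  case (eng g h)
  then have "act (g \<otimes> h) x = act g (act h x)"
    using generate_in_carrier[OF K] N by (auto intro!: act_mult)
  with eng show ?case by simp
qed (auto intro: inv)

text \<open>Limits of translations that send \<open>y\<close> into \<open>N\<close> form a compact
  semigroup under composition. An idempotent \<open>u\<close> there moves the pair of
  \<open>y\<close> and \<open>u y\<close> to a diagonal point, so distality gives
  \<open>y = u y\<close>.\<close>

lemma distal_orbit_approaching_compact_invariant:
  assumes X: "Hausdorff_space X" and "distal"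
    and N: "compactin X N" "\<And>g x. g \<in> carrier G \<Longrightarrow> x \<in> N \<Longrightarrow> act g x \<in> N"
    and C: "\<And>n. compactin X (C n)" "decseq C" "(\<Inter>n. C n) = N"
    and y: "y \<in> topspace X" "\<And>n::nat. \<exists>g\<in>carrier G. act g y \<in> C n"
  shows "y \<in> N"
proof -
  \<comment> \<open>Recording maps only on \<open>D\<close> yields compactness without a compact
    \<open>X\<close>: on \<open>N\<close> the values stay in \<open>N\<close>, and the value at
    \<open>y\<close> is confined by \<open>M\<close> in \<open>F M\<close>. \<open>E\<close> is the
    enveloping semigroup seen on \<open>D\<close>, with pointwise convergence.\<close>
  define D where "D = insert y N"
  define Y where "Y = product_topology (\<lambda>_. X) D"
  define \<phi> where "\<phi> g = restrict (act g) D" for g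
  define E where "E = Y closure_of (\<phi> ` carrier G)"
  define f where "f a b = restrict (a \<circ> b) D" for a b :: "'x \<Rightarrow> 'x"
  define F where "F M = E \<inter> Pi\<^sub>E D (\<lambda>x. if x \<in> N then N else M)" for M
  have Nsub: "N \<subseteq> topspace X" using N compactin_subset_topspace by blast
  have Dsub: "D \<subseteq> topspace X" using Nsub y by (auto simp: D_def)
  have "N \<subseteq> D" "y \<in> D" by (auto simp: D_def)
  have Y: "Hausdorff_space Y" "topspace Y = Pi\<^sub>E D (\<lambda>_. topspace X)"
    using X by (auto simp: Y_def Hausdorff_space_product_topology)
  have E: "closedin Y E" "E \<subseteq> topspace Y"
    by (auto simp: E_def closure_of_subset_topspace)
  have \<phi>Y: "\<phi> g \<in> topspace Y" if "g \<in> carrier G" for g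
    using that Dsub act_closed by (auto simp: \<phi>_def Y)
  have \<phi>E: "\<phi> g \<in> E" if "g \<in> carrier G" for g
    using that \<phi>Y closure_of_subset[of "\<phi> ` carrier G" Y] by (auto simp: E_def)
  have compF: "compactin Y (F M)" if "compactin X M" for M
    unfolding F_def
    by (rule closed_Int_compactin[OF E(1)]) (use that N in \<open>auto simp: Y_def compactin_PiE\<close>)
  have Fmono: "F M \<subseteq> F M'" if "M \<subseteq> M'" for M M'
    using that by (force simp: F_def PiE_iff)
  have FI: "\<phi> g \<in> F M" if "g \<in> carrier G" "act g y \<in> M" for g M
    using that \<phi>E N by (auto simp: F_def \<phi>_def D_def)
  text \<open>Composition is continuous in its left argument, but in its right argument only when the
    left one comes from a group element, so closedness of \<open>E\<close> takes two limits.\<close>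
  have left: "f (\<phi> g) a \<in> E" if g: "g \<in> carrier G" and a: "a \<in> F N" for g a
  proof -
    have "continuous_map Y Y (\<lambda>b. restrict (\<lambda>x. act g (b x)) D)"
      unfolding Y_def
      by (subst continuous_map_componentwise)
         (auto intro!: continuous_map_compose[OF _ continuous_map_act[OF g], unfolded o_def]
         continuous_map_product_projection)
    from continuous_map_image_closure_subset[OF this, of "\<phi> ` carrier G"]
    have "(\<lambda>b. restrict (\<lambda>x. act g (b x)) D) ` E
            \<subseteq> Y closure_of ((\<lambda>b. restrict (\<lambda>x. act g (b x)) D) ` \<phi> ` carrier G)"
      by (simp add: E_def)
    also have "\<dots> \<subseteq> E"
      unfolding E_def
    proof (rule closure_of_mono, clarsimp)
      fix h assume h: "h \<in> carrier G"
      have "restrict (\<lambda>x. act g (\<phi> h x)) D = \<phi> (g \<otimes> h)"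
        using g h Dsub by (auto simp: \<phi>_def act_mult subset_iff)
      with g h show "restrict (\<lambda>x. act g (\<phi> h x)) D \<in> \<phi> ` carrier G" by blast
    qed
    finally have "restrict (\<lambda>x. act g (a x)) D \<in> E" using a by (auto simp: F_def)
    moreover have "a x \<in> D" if "x \<in> D" for x
      using a that \<open>N \<subseteq> D\<close> by (auto simp: F_def PiE_iff split: if_splits)
    then have "f (\<phi> g) a = restrict (\<lambda>x. act g (a x)) D"
      by (auto simp: f_def \<phi>_def)
    ultimately show ?thesis by simp
  qed
  have FN: "a x \<in> N" if "a \<in> F N" "x \<in> D" for a x
    using that by (auto simp: F_def PiE_iff split: if_splits)
  have right_cont: "continuous_map Y Y (\<lambda>a. f a b)" if b: "b \<in> F N" for b
    unfolding Y_def f_def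
    by (subst continuous_map_componentwise)
       (use FN[OF b] \<open>N \<subseteq> D\<close> in \<open>auto intro!: continuous_map_product_projection\<close>)
  have right: "f a b \<in> E" if a: "a \<in> E" and b: "b \<in> F N" for a b
  proof -
    have "(\<lambda>a. f a b) ` E \<subseteq> Y closure_of ((\<lambda>a. f a b) ` \<phi> ` carrier G)"
      unfolding E_def by (rule continuous_map_image_closure_subset[OF right_cont[OF b]])
    also have "\<dots> \<subseteq> E"
      by (rule closure_of_minimal) (use left b E in auto)
    finally show ?thesis using a by blast
  qed
  \<comment> \<open>Elements of \<open>F N\<close> map all of \<open>D\<close> into
    \<open>N\<close>, so composites make sense on \<open>D\<close> and again land in
    \<open>N\<close>.\<close>
  have closed: "f a b \<in> F N" if "a \<in> F N" "b \<in> F N" for a b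
    using that right[of a b] FN \<open>N \<subseteq> D\<close> by (auto simp: F_def[of N] f_def)
  let ?Z = "subtopology Y (F N)"
  have top: "topspace ?Z = F N"
    using compactin_subset_topspace[OF compF[OF N(1)]] by auto
  have "F N \<noteq> {}"
  proof -
    \<comment> \<open>Each \<open>F (C n)\<close> contains the translation by an element moving
      \<open>y\<close> into \<open>C n\<close>. A common point of these nested compact sets sends
      \<open>y\<close> into every \<open>C n\<close>, hence into \<open>N\<close>.\<close>
    have "(\<Inter>n. F (C n)) \<noteq> {}"
    proof (rule compact_space_imp_nest)
      show "compact_space (subtopology Y (F (C 0)))"
        by (intro compact_space_subtopology compF C)
      show "closedin (subtopology Y (F (C 0))) (F (C n))" for n
      proof -
        have "F (C n) \<subseteq> F (C 0)"
          using \<open>decseq C\<close> by (intro Fmono) (simp add: decseq_def)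
        then show ?thesis
          by (intro closedin_subset_topspace compactin_imp_closedin Y compF C)
      qed
      show "F (C n) \<noteq> {}" for n using y(2) FI by blast
      show "decseq (\<lambda>n. F (C n))"
        using \<open>decseq C\<close> Fmono by (simp add: decseq_def)
    qed
    moreover have "(\<Inter>n. F (C n)) \<subseteq> F N"
      using C(3) by (fastforce simp: F_def PiE_iff split: if_splits)
    ultimately show ?thesis by blast
  qed
  obtain u where u: "u \<in> F N" "f u u = u"
  proof (rule compact_right_topological_semigroup_idempotent[of ?Z f])
    show "compact_space ?Z" by (intro compact_space_subtopology compF N)
    show "Hausdorff_space ?Z" using Y by (simp add: Hausdorff_space_subtopology)
    show "topspace ?Z \<noteq> {}" using top \<open>F N \<noteq> {}\<close> by simp
    show "f a b \<in> topspace ?Z" if "a \<in> topspace ?Z" "b \<in> topspace ?Z" for a b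
      using closed that unfolding top .
    show "f (f a b) c = f a (f b c)"
      if "a \<in> topspace ?Z" "b \<in> topspace ?Z" "c \<in> topspace ?Z" for a b c
      using FN[of c] FN[of b] that \<open>N \<subseteq> D\<close> unfolding top by (auto simp: f_def subset_iff)
    show "continuous_map ?Z ?Z (\<lambda>a. f a b)" if "b \<in> topspace ?Z" for b
      using that closed unfolding top
      by (auto simp: continuous_map_in_subtopology intro!: continuous_map_from_subtopology right_cont)
  qed (use top that in auto)
  define z where "z = u y"
  have z: "z \<in> N" using FN u \<open>y \<in> D\<close> by (simp add: z_def)
  \<comment> \<open>Evaluate \<open>f u u = u\<close> at \<open>y\<close>.\<close>
  have uz: "u z = z"
    using fun_cong[OF u(2), of y] \<open>y \<in> D\<close> by (simp add: f_def z_def)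
  \<comment> \<open>Evaluation at \<open>y\<close> and \<open>z\<close> carries the closure
    \<open>E\<close> into the closure of the orbit of the pair, and carries \<open>u\<close> to
    \<open>(z, z)\<close>.\<close>
  have "continuous_map Y (prod_topology X X) (\<lambda>a. (a y, a z))"
    unfolding Y_def using \<open>y \<in> D\<close> z \<open>N \<subseteq> D\<close>
    by (intro continuous_map_pairedI continuous_map_product_projection) auto
  from continuous_map_image_closure_subset[OF this, of "\<phi> ` carrier G"]
  have "(\<lambda>a. (a y, a z)) ` E
          \<subseteq> prod_topology X X closure_of ((\<lambda>a. (a y, a z)) ` \<phi> ` carrier G)"
    by (simp add: E_def)
  also have "(\<lambda>a. (a y, a z)) ` \<phi> ` carrier G = {(act g y, act g z) |g. g \<in> carrier G}"
    using \<open>y \<in> D\<close> z \<open>N \<subseteq> D\<close> by (auto simp: \<phi>_def image_iff subset_iff)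
  finally have "(u y, u z) \<in> prod_topology X X closure_of {(act g y, act g z) |g. g \<in> carrier G}"
    using u by (auto simp: F_def)
  then have "(z, z) \<in> prod_topology X X closure_of {(act g y, act g z) |g. g \<in> carrier G}"
    by (simp add: uz z_def[symmetric])
  then have "y = z"
    using \<open>distal\<close> y(1) z Nsub unfolding distal_def by blast
  with z show ?thesis by simp
qed

text \<open>Compact generation turns the condition over all of \<open>G\<close> into iterated steps
  from a compact set, each of which preserves openness; distality makes the iteration stop.\<close>

theorem openin_stay_carrier:
  assumes X: "Hausdorff_space X" and "distal"
    and K: "compactin T K" "generate G K = carrier G"
    and U: "compactin X U" "openin X U"
  shows "openin X (stay (carrier G) U)"
proof -
  \<comment> \<open>The unit makes the sets \<open>W n\<close> decrease; the inverses turn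
    invariance under \<open>A\<close> into invariance under the generated group.\<close>
  define A where "A = insert \<one> (K \<union> m_inv G ` K)"
  define W where "W n = (stay A ^^ n) U" for n
  have Ksub: "K \<subseteq> carrier G" using K compactin_subset_topspace topspace_eq_carrier by blast
  have A: "compactin T A"
    unfolding A_def using K image_compactin[OF K(1) continuous_inv] topspace_eq_carrier
    by (metis compactin_Un compactin_sing insert_is_Un one_closed)
  have Asub: "A \<subseteq> carrier G" using Ksub by (auto simp: A_def)
  have W0: "W 0 = U" and WSuc: "W (Suc n) = stay A (W n)" for n
    by (auto simp: W_def)
  have Wsub: "W (Suc n) \<subseteq> W n" for n
    unfolding WSuc by (rule stay_subset) (simp add: A_def)
  then have Wdec: "decseq W" by (rule decseq_SucI)
  have Wopen: "openin X (W n)" for n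
    by (induction n) (auto simp: W0 WSuc U A openin_stay)
  have Wclosed: "closedin X (W n)" for n
    by (induction n) (auto simp: W0 WSuc U X Asub closedin_stay compactin_imp_closedin)
  have Wcomp: "compactin X (W n)" for n
    using U(1) _ Wclosed by (rule closed_compactin) (use Wdec W0 in \<open>auto simp: decseq_def\<close>)
  have Wtop: "W n \<subseteq> topspace X" for n using Wopen openin_subset by blast
  have stay_subset_W: "stay (carrier G) U \<subseteq> W n" for n
  proof (induction n)
    case 0
    then show ?case by (simp add: W0 stay_subset)
  next
    case (Suc n)
    have "act k x \<in> stay (carrier G) U" if "x \<in> stay (carrier G) U" "k \<in> A" for k x
      using that Asub by (auto simp: stay_def act_closed simp flip: act_mult)
    with Suc show ?case by (auto simp: WSuc stay_def)
  qed
  \<comment> \<open>Together with \<open>stay_subset_W\<close> this is a sandwich: a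
    \<open>W n\<close>, or their intersection, equals \<open>stay (carrier G) U\<close> once it is
    invariant under \<open>A\<close>.\<close>
  have subset_stay: "N \<subseteq> stay (carrier G) U"
    if N: "N \<subseteq> U" "\<And>k x. k \<in> A \<Longrightarrow> x \<in> N \<Longrightarrow> act k x \<in> N" for N
  proof
    fix x assume x: "x \<in> N"
    have "N \<subseteq> topspace X" using N Wtop[of 0] by (simp add: W0)
    with x have "act g x \<in> N" if "g \<in> carrier G" for g
      using that unfolding K(2)[symmetric]
      by (intro generate_invariant[OF Ksub, of N g x]) (auto simp: A_def N(2))
    then show "x \<in> stay (carrier G) U" using N \<open>N \<subseteq> topspace X\<close> x by (auto simp: stay_def)
  qed
  have "\<exists>n. W n \<subseteq> W (Suc n)"
  proof (rule ccontr)
    assume "\<nexists>n. W n \<subseteq> W (Suc n)"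
    then have ne: "\<exists>w. w \<in> W n - W (Suc n)" for n by blast
    \<comment> \<open>All steps from \<open>w\<close> land in \<open>W n\<close>, and failure of the
      next condition means that one of them misses \<open>W (Suc n)\<close>.\<close>
    have step: "\<exists>k\<in>A. act k w \<in> W n - W (Suc n)" if "w \<in> W (Suc n) - W (Suc (Suc n))" for n w
      using that unfolding WSuc[of "Suc n"] by (subst (asm) WSuc) (auto simp: stay_def)
    have path: "\<exists>y\<in>(push A ^^ n) S. y \<in> W 0 - W 1" if "w \<in> S" "w \<in> W n - W (Suc n)" for n w S
      using that
    proof (induction n arbitrary: w S)
      case (Suc n)
      then obtain k where "k \<in> A" "act k w \<in> W n - W (Suc n)" using step by blast
      moreover from this Suc.prems have "act k w \<in> push A S" by (auto simp: push_def)
      ultimately show ?case using Suc.IH by (simp add: funpow_Suc_right del: funpow.simps)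
    qed auto
    define P where "P n = (push A ^^ n) (W n)" for n
    have Pcomp: "compactin X (P n)" for n
    proof -
      have "compactin X ((push A ^^ m) (W n))" for m
        by (induction m) (auto simp: Wcomp compactin_push A)
      then show ?thesis by (simp add: P_def)
    qed
    \<comment> \<open>\<open>funpow_Suc_right\<close> splits off the first step of the walk, which
      takes \<open>W (Suc n)\<close> into \<open>W n\<close>.\<close>
    have Pdec: "decseq P"
    proof (rule decseq_SucI)
      fix n
      have "push A (W (Suc n)) \<subseteq> W n" unfolding WSuc by (rule push_stay_subset)
      then show "P (Suc n) \<subseteq> P n"
        by (auto simp: P_def funpow_Suc_right simp del: funpow.simps dest: push_pow_mono)
    qed
    \<comment> \<open>\<open>W 0 - W 1\<close> is closed because \<open>W 1\<close> is open, so
      these are nested nonempty closed sets in the compact \<open>W 0\<close>.\<close>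
    have "(\<Inter>n. P n \<inter> (W 0 - W 1)) \<noteq> {}"
    proof (rule compact_space_imp_nest)
      show "compact_space (subtopology X (W 0))" by (intro compact_space_subtopology Wcomp)
      show "closedin (subtopology X (W 0)) (P n \<inter> (W 0 - W 1))" for n
        by (intro closedin_subset_topspace closedin_Int closedin_diff Wclosed Wopen
              compactin_imp_closedin X Pcomp) auto
      show "P n \<inter> (W 0 - W 1) \<noteq> {}" for n
        using ne[of n] path by (fastforce simp: P_def)
      show "decseq (\<lambda>n. P n \<inter> (W 0 - W 1))" using Pdec by (auto simp: decseq_def)
    qed
    then obtain y where y: "\<And>n. y \<in> P n" "y \<in> W 0" "y \<notin> W 1" by auto
    define N where "N = (\<Inter>n. W n)"
    have N_eq: "N = stay (carrier G) U"
    proof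
      have "act k x \<in> N" if "k \<in> A" "x \<in> N" for k x
      proof -
        have "x \<in> stay A (W n)" for n using that WSuc by (auto simp: N_def)
        with that show ?thesis by (auto simp: N_def stay_def)
      qed
      moreover have "N \<subseteq> U" using W0 by (auto simp: N_def)
      ultimately show "N \<subseteq> stay (carrier G) U" by (rule subset_stay[rotated])
    qed (use stay_subset_W in \<open>auto simp: N_def\<close>)
    have "y \<in> N"
    proof (rule distal_orbit_approaching_compact_invariant[OF X \<open>distal\<close> _ _ Wcomp Wdec])
      show "compactin X N"
        using Wcomp[of 0] by (rule closed_compactin) (auto simp: N_def Wclosed)
      show "act g x \<in> N" if "g \<in> carrier G" "x \<in> N" for g x
        using that unfolding N_eq by (auto simp: stay_def act_closed simp flip: act_mult)
      show "(\<Inter>n. W n) = N" by (simp add: N_def)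
      show "y \<in> topspace X" using y Wtop by blast
      \<comment> \<open>Run the walk from \<open>W n\<close> to \<open>y\<close> backwards.\<close>
      show "\<exists>g\<in>carrier G. act g y \<in> W n" for n
      proof -
        obtain x g where xg: "x \<in> W n" "g \<in> carrier G" "y = act g x"
          using push_pow_imp_orbit[OF Asub Wtop] y(1)[of n] unfolding P_def by blast
        then have "act (inv g) y \<in> W n" using Wtop act_inv[OF xg(2)] by (simp add: subset_iff)
        with xg show ?thesis by blast
      qed
    qed
    with y show False by (auto simp: N_def)
  qed
  then obtain n where n: "W n \<subseteq> W (Suc n)" by blast
  have "W n \<subseteq> stay (carrier G) U"
  proof (rule subset_stay)
    show "W n \<subseteq> U" using decseqD[OF Wdec, of 0 n] W0 by simp
  qed (use n in \<open>auto simp: WSuc stay_def\<close>)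
  with stay_subset_W[of n] have "stay (carrier G) U = W n" by blast
  with Wopen show ?thesis by simp
qed

end

section \<open>The conjugation action\<close>

context topological_group
begin

lemma continuous_action_conj: "continuous_action G T T (conj_by G)"
proof
  have fst: "continuous_map (prod_topology T T) T fst"
    and snd: "continuous_map (prod_topology T T) T snd"
    by (auto simp: continuous_map_fst continuous_map_snd)
  have mult: "continuous_map (prod_topology T T) T (\<lambda>p. f p \<otimes> g p)"
    if "continuous_map (prod_topology T T) T f" "continuous_map (prod_topology T T) T g" for f g
    using continuous_map_compose[OF continuous_map_pairedI[OF that] continuous_mult]
    by (simp add: o_def)
  have "continuous_map (prod_topology T T) T (\<lambda>p. fst p \<otimes> snd p \<otimes> inv (fst p))"
    using continuous_map_compose[OF fst continuous_inv] by (intro mult fst snd) (simp add: o_def)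
  then show "continuous_map (prod_topology T T) T (\<lambda>(g, x). conj_by G g x)"
    by (simp add: conj_by_def case_prod_unfold)
qed (auto simp: conj_by_def topspace_eq_carrier m_assoc inv_mult_group)

text \<open>A proximal pair in \<open>H\<close> is one in \<open>G\<close>: there are more
  conjugators, and closures in the subspace lie in closures in the whole space.\<close>

lemma distal_group_subgroup:
  assumes "distal_group G T" and H: "subgroup H G"
  shows "distal_group (G\<lparr>carrier := H\<rparr>) (subtopology T H)"
proof -
  have sub: "H \<subseteq> carrier G" using H by (rule subgroup.subset)
  have conj: "conj_by (G\<lparr>carrier := H\<rparr>) g = conj_by G g" if "g \<in> H" for g
    using that m_inv_consistent[OF H] by (auto simp: conj_by_def)
  have "(z, z) \<in> prod_topology T T closure_of {(conj_by G g x, conj_by G g y) |g. g \<in> carrier G}"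
    if "(z, z) \<in> prod_topology (subtopology T H) (subtopology T H) closure_of
          {(conj_by (G\<lparr>carrier := H\<rparr>) g x, conj_by (G\<lparr>carrier := H\<rparr>) g y) |g. g \<in> H}" for x y z
  proof -
    have "prod_topology (subtopology T H) (subtopology T H) closure_of
            {(conj_by (G\<lparr>carrier := H\<rparr>) g x, conj_by (G\<lparr>carrier := H\<rparr>) g y) |g. g \<in> H}
          \<subseteq> prod_topology T T closure_of
            {(conj_by (G\<lparr>carrier := H\<rparr>) g x, conj_by (G\<lparr>carrier := H\<rparr>) g y) |g. g \<in> H}"
      by (simp add: closure_of_subtopology_subset flip: subtopology_Times)
    also have "\<dots> \<subseteq> prod_topology T T closure_of
                      {(conj_by G g x, conj_by G g y) |g. g \<in> carrier G}"
      using sub conj by (intro closure_of_mono) auto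
    finally show ?thesis using that by blast
  qed
  then show ?thesis
    using assms(1) sub unfolding distal_group_def by simp blast
qed

lemma distal_group_iff: "distal_group G T \<longleftrightarrow> continuous_action.distal G T (conj_by G)"
  unfolding distal_group_def continuous_action.distal_def[OF continuous_action_conj]
    topspace_eq_carrier by blast

text \<open>Invariance under \<open>inv g\<close> supplies the preimages.\<close>

lemma conj_invariant_image:
  assumes "V \<subseteq> carrier G" and inv: "\<And>g x. g \<in> carrier G \<Longrightarrow> x \<in> V \<Longrightarrow> conj_by G g x \<in> V"
    and g: "g \<in> carrier G"
  shows "conj_by G g ` V = V"
proof -
  have "x = conj_by G g (conj_by G (inv g) x)" if "x \<in> V" for x
  proof -
    interpret continuous_action G T T "conj_by G" by (rule continuous_action_conj)
    show ?thesis using act_inv[of "inv g" x] g that assms(1) topspace_eq_carrier by auto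
  qed
  with inv g show ?thesis by blast
qed

theorem distal_compactly_generated_imp_SIN:
  assumes td: "totally_disconnected_space T" and lc: "locally_compact_space T"
    and "distal_group G T" and "compactly_generated_group G T"
  shows "SIN_group G T"
  unfolding SIN_group_def neighbourhood_base_at_def
proof clarify
  interpret continuous_action G T T "conj_by G" by (rule continuous_action_conj)
  fix W assume W: "openin T W" "\<one> \<in> W"
  obtain U0 C where U0: "openin T U0" "compactin T C" "\<one> \<in> U0" "U0 \<subseteq> C"
    using lc topspace_eq_carrier one_closed unfolding locally_compact_space_def by metis
  \<comment> \<open>As \<open>{\<one>}\<close> is a compact component, it has a clopen neighbourhood
    \<open>U\<close> inside \<open>W \<inter> U0\<close>; being closed in the compact
    \<open>C\<close>, \<open>U\<close> is compact.\<close>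
  have "{\<one>} \<in> connected_components_of T"
    using td topspace_eq_carrier one_closed
    unfolding totally_disconnected_space_def connected_components_of_def by (metis imageI)
  moreover have "openin T (W \<inter> U0)" using W U0 by blast
  ultimately obtain U V where U: "openin T U" "openin T V" "disjnt U V" "U \<union> V = topspace T"
    "\<one> \<in> U" "U \<subseteq> W \<inter> U0"
    using wilder_locally_compact_component_thm[OF lc Hausdorff, of "{\<one>}" "W \<inter> U0"] W U0
      topspace_eq_carrier by (auto simp: compactin_sing)
  have "U = topspace T - V" using U by (auto simp: disjnt_def)
  then have "compactin T U"
    using U U0 by (intro closed_compactin[OF U0(2)]) auto
  obtain K where K: "compactin T K" "generate G K = carrier G"
    using assms(4) unfolding compactly_generated_group_def by blast
  \<comment> \<open>This set serves both as the open set and as the invariant neighbourhood.\<close>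
  let ?S = "stay (carrier G) U"
  have "openin T ?S"
    using openin_stay_carrier Hausdorff \<open>distal_group G T\<close> K \<open>compactin T U\<close> U(1)
    by (simp add: distal_group_iff)
  moreover have "\<one> \<in> ?S"
    using U topspace_eq_carrier by (auto simp: stay_def conj_by_def)
  moreover have "?S \<subseteq> W" using stay_subset[of "carrier G" U] U by auto
  moreover have "conj_by G g ` ?S = ?S" if "g \<in> carrier G" for g
  proof (rule conj_invariant_image[OF _ _ that])
    show "?S \<subseteq> carrier G" using topspace_eq_carrier by (auto simp: stay_def)
    show "conj_by G h x \<in> ?S" if "h \<in> carrier G" "x \<in> ?S" for h x
      using that by (auto simp: stay_def act_closed simp flip: act_mult)
  qed
  ultimately show "\<exists>U V. openin T U \<and> (\<forall>g\<in>carrier G. conj_by G g ` V = V) \<and> \<one> \<in> U \<and> U \<subseteq> V \<and> V \<subseteq> W"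
    by (intro exI[of _ ?S]) simp
qed

end

section \<open>Passage to closed subgroups\<close>

lemma totally_disconnected_space_subtopology:
  assumes "totally_disconnected_space T"
  shows "totally_disconnected_space (subtopology T S)"
  unfolding totally_disconnected_space_def
proof
  fix x assume x: "x \<in> topspace (subtopology T S)"
  have "connected_component_of (subtopology T S) x y \<Longrightarrow> y = x" for y
    using assms x unfolding totally_disconnected_space_def connected_component_of_def
    by (fastforce simp: connectedin_subtopology)
  with x show "connected_component_of_set (subtopology T S) x = {x}"
    by (auto simp: connected_component_of_refl)
qed

theorem corollary1p9:
  fixes G :: "('a, 'b) monoid_scheme" and T :: "'a topology"
  assumes "topological_group G T"
    and "totally_disconnected_space T"
    and "locally_compact_space T"
    and "distal_group G T"
  shows "\<forall>H. subgroup H G \<and> closedin T H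
           \<and> compactly_generated_group (G\<lparr>carrier := H\<rparr>) (subtopology T H)
           \<longrightarrow> SIN_group (G\<lparr>carrier := H\<rparr>) (subtopology T H)"
proof clarify
  fix H assume H: "subgroup H G" "closedin T H"
    and "compactly_generated_group (G\<lparr>carrier := H\<rparr>) (subtopology T H)"
  \<comment> \<open>Closedness of \<open>H\<close> gives local compactness; total disconnectedness
    and distality are inherited by the subgroup.\<close>
  then show "SIN_group (G\<lparr>carrier := H\<rparr>) (subtopology T H)"
    using assms topological_group.topological_group_subgroup[OF assms(1) H(1)]
    by (intro topological_group.distal_compactly_generated_imp_SIN
        totally_disconnected_space_subtopology locally_compact_space_closed_subset
        topological_group.distal_group_subgroup)
qed

end
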